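(* Let $2<q<\infty$, $s\in\mathbb N$, $\alpha_1,\dots,\alpha_s\in\mathbb R$, $p_1,\dots,p_s\in[1,\infty]$. Suppose that: (a) $\alpha_1<\dots<\alpha_s$ and $\alpha_1-\frac1{p_1}>\dots>\alpha_s-\frac1{p_s}$; (b) there is $j$ with $p_j<q$ and there is $j$ with $p_j>2$; (c) $p_j\notin\{2,q\}$ for all $j$; (d) $\frac{\alpha_{i}-\alpha_{j}}{1/p_{i}-1/p_{j}}\ne\frac{\alpha_{i'}-\alpha_{j'}}{1/p_{i'}-1/p_{j'}}$ whenever $i>j$, $i'>j'$, $(i,j)\ne(i',j')$. Let $I,J,K$, $(i_0,j_0)$, $(i_1,j_1)$, $h_0,h_1,\varphi_j,h$ be as defined in the context. Let $1<t_1<t_2<\dots<t_{L-1}<\frac q2$ be the corner points of $h$, $t_0:=1$, $t_L:=q/2$. Then: 1. if $2\le l\le L-1$, then $h|_{[t_{l-1},t_l]}=\varphi_{j(l)}|_{[t_{l-1},t_l]}$ for some $j(l)\in J$; 2. if $K=\varnothing$, then $h|_{[t_0,t_1]}=\varphi_{j(1)}|_{[t_0,t_1]}$, where $j(1)=s\in J$; 3. if $K\ne\varnothing$, then $h|_{[t_0,t_1]}=h_1|_{[t_0,t_1]}$; if, in addition, $i_1\in J$, then $h(t)=\varphi_{i_1}(t)$ in a right semi-neighborhood of the point $t_1$; if $i_1\in I$, then $L=2$, $(i_0,j_0)=(i_1,j_1)$ and $h|_{[t_1,t_2]}=h_0|_{[t_1,t_2]}$; 4. if $I=\varnothing$, then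 $h|_{[t_{L-1},t_L]}=\varphi_{j(L)}|_{[t_{L-1},t_L]}$, where $j(L)=1\in J$; 5. if $I\ne\varnothing$, then $h|_{[t_{L-1},t_L]}=h_0|_{[t_{L-1},t_L]}$; if, in addition, $j_0\in J$, then $h(t)=\varphi_{j_0}(t)$ in a left semi-neighborhood of the point $t_{L-1}$; if $j_0\in K$, then $L=2$, $(i_1,j_1)=(i_0,j_0)$ and $h|_{[t_0,t_1]}=h_1|_{[t_0,t_1]}$; 6. the sequence $\{j(l)\}_l$ strictly decreases in $l$.
   Context: $1/\infty:=0$. Let $I=\{j:p_j>q\}$, $J=\{j:2<p_j<q\}$, $K=\{j:p_j<2\}$ (subsets of $\{1,\dots,s\}$), so $\{1,\dots,s\}=I\sqcup J\sqcup K$. Define $\lambda_{i,j}$ ($i\in I$, $j\in J\sqcup K$) and $\tilde\lambda_{i,j}$ ($i\in I\sqcup J$, $j\in K$) by $\frac1q=\frac{1-\lambda_{i,j}}{p_i}+\frac{\lambda_{i,j}}{p_j}$ and $\frac12=\frac{1-\tilde\lambda_{i,j}}{p_i}+\frac{\tilde\lambda_{i,j}}{p_j}$. If $I\ne\varnothing$, $(i_0,j_0)$ is the (unique) maximizer of $(1-\lambda_{i,j})\alpha_i+\lambda_{i,j}\alpha_j$ over $i\in I$, $j\in J\sqcup K$; if $K\ne\varnothing$, $(i_1,j_1)$ is the (unique) maximizer of $(1-\tilde\lambda_{i,j})\alpha_i+\tilde\lambda_{i,j}\alpha_j$ over $i\in I\sqcup J$, $j\in K$. For $t\in[1,q/2]$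 let $h_0(t)=t((1-\lambda_{i_0,j_0})\alpha_{i_0}+\lambda_{i_0,j_0}\alpha_{j_0})$ if $I\ne\varnothing$, $h_0\equiv-\infty$ if $I=\varnothing$; $h_1(t)=t((1-\tilde\lambda_{i_1,j_1})\alpha_{i_1}+\tilde\lambda_{i_1,j_1}\alpha_{j_1}-\frac12)+\frac12$ if $K\ne\varnothing$, $h_1\equiv-\infty$ if $K=\varnothing$; $\varphi_j(t)=t\bigl(\alpha_j-\frac12\cdot\frac{1/p_j-1/q}{1/2-1/q}\bigr)+\frac12\cdot\frac{1/p_j-1/q}{1/2-1/q}$, $j=1,\dots,s$; $h_2(t)=\max_{j\in J}\varphi_j(t)$ if $J\ne\varnothing$, $h_2\equiv-\infty$ if $J=\varnothing$; $h(t)=\max\{h_0(t),h_1(t),h_2(t)\}$. Corner points of the convex piecewise affine function $h$ are its points of non-differentiability in $(1,q/2)$. The indices $j(l)$ are defined for $l\in\{2,\dots,L-1\}$, as well as for $l=1$ in the case $K=\varnothing$ and for $l=L$ in the case $I=\varnothing$. (In the paper $\alpha_j=r_j-l$ with $r_j,l>0$, i.e. the $\alpha_j$ are arbitrary reals subject to (a)–(d).) *)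

theory Defs
  imports Complex_Main "HOL-Library.Extended_Real"
begin

text \<open>Exponents live in \<open>[1,\<infinity>]\<close>, so they are extended reals; in \<^typ>\<open>ereal\<close> one has
  \<open>1 / \<infinity> = 0\<close>, which is the convention used here.\<close>

definition recip :: "ereal \<Rightarrow> real" where
  "recip r = real_of_ereal (1 / r)"

definition idxI :: "real \<Rightarrow> nat \<Rightarrow> (nat \<Rightarrow> ereal) \<Rightarrow> nat set" where
  "idxI q s p = {j \<in> {1..s}. p j > ereal q}"

definition idxJ :: "real \<Rightarrow> nat \<Rightarrow> (nat \<Rightarrow> ereal) \<Rightarrow> nat set" where
  "idxJ q s p = {j \<in> {1..s}. 2 < p j \<and> p j < ereal q}"

definition idxK :: "nat \<Rightarrow> (nat \<Rightarrow> ereal) \<Rightarrow> nat set" where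
  "idxK s p = {j \<in> {1..s}. p j < 2}"

text \<open>\<open>weight q p i j\<close> is \<open>\<lambda>\<^bsub>i,j\<^esub>\<close> and \<open>weight 2 p i j\<close> is its variant with a tilde. The equation
  has a unique solution whenever \<open>p i \<noteq> p j\<close> (both in \<open>[1,\<infinity>]\<close>).\<close>

definition weight :: "real \<Rightarrow> (nat \<Rightarrow> ereal) \<Rightarrow> nat \<Rightarrow> nat \<Rightarrow> real" where
  "weight r p i j = (THE c. 1 / r = (1 - c) * recip (p i) + c * recip (p j))"

lemma weight_unique:
  assumes "recip (p i) \<noteq> recip (p j)"
  shows "1 / r = (1 - c) * recip (p i) + c * recip (p j) \<longleftrightarrow> c = weight r p i j"
proof -
  have *: "1 / r = (1 - c) * recip (p i) + c * recip (p j) \<longleftrightarrow>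
      c = (1 / r - recip (p i)) / (recip (p j) - recip (p i))" for c
  proof -
    have "1 / r = (1 - c) * recip (p i) + c * recip (p j) \<longleftrightarrow>
        c * (recip (p j) - recip (p i)) = 1 / r - recip (p i)"
      by (auto simp: algebra_simps)
    then show ?thesis
      using assms by (simp add: eq_divide_eq)
  qed
  then show ?thesis
    unfolding weight_def by simp
qed

definition interp :: "real \<Rightarrow> (nat \<Rightarrow> real) \<Rightarrow> (nat \<Rightarrow> ereal) \<Rightarrow> nat \<Rightarrow> nat \<Rightarrow> real" where
  "interp r \<alpha> p i j = (1 - weight r p i j) * \<alpha> i + weight r p i j * \<alpha> j"

definition phi :: "real \<Rightarrow> (nat \<Rightarrow> real) \<Rightarrow> (nat \<Rightarrow> ereal) \<Rightarrow> nat \<Rightarrow> real \<Rightarrow> real" where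
  "phi q \<alpha> p j t =
     t * (\<alpha> j - 1/2 * ((recip (p j) - 1/q) / (1/2 - 1/q)))
       + 1/2 * ((recip (p j) - 1/q) / (1/2 - 1/q))"

text \<open>The maximizing pairs \<open>(i0, j0)\<close> and \<open>(i1, j1)\<close> are passed as arguments. The values of
  \<open>h0\<close>, \<open>h1\<close>, \<open>h2\<close> are extended reals because \<open>-\<infinity>\<close> stands for an absent function.\<close>

definition h0 :: "real \<Rightarrow> nat \<Rightarrow> (nat \<Rightarrow> real) \<Rightarrow> (nat \<Rightarrow> ereal) \<Rightarrow> nat \<times> nat \<Rightarrow> real \<Rightarrow> ereal" where
  "h0 q s \<alpha> p ij t =
     (if idxI q s p \<noteq> {} then ereal (t * interp q \<alpha> p (fst ij) (snd ij)) else -\<infinity>)"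

definition h1 :: "nat \<Rightarrow> (nat \<Rightarrow> real) \<Rightarrow> (nat \<Rightarrow> ereal) \<Rightarrow> nat \<times> nat \<Rightarrow> real \<Rightarrow> ereal" where
  "h1 s \<alpha> p ij t =
     (if idxK s p \<noteq> {} then ereal (t * (interp 2 \<alpha> p (fst ij) (snd ij) - 1/2) + 1/2) else -\<infinity>)"

definition h2 :: "real \<Rightarrow> nat \<Rightarrow> (nat \<Rightarrow> real) \<Rightarrow> (nat \<Rightarrow> ereal) \<Rightarrow> real \<Rightarrow> ereal" where
  "h2 q s \<alpha> p t =
     (if idxJ q s p \<noteq> {} then ereal (MAX j\<in>idxJ q s p. phi q \<alpha> p j t) else -\<infinity>)"

text \<open>The maximum is finite as soon as one of the three index sets is nonempty, and then
  \<^const>\<open>real_of_ereal\<close> loses nothing. The formula is used on all of \<open>\<real>\<close>, but only its values on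
  \<open>[1, q/2]\<close> matter.\<close>

definition hmax ::
  "real \<Rightarrow> nat \<Rightarrow> (nat \<Rightarrow> real) \<Rightarrow> (nat \<Rightarrow> ereal) \<Rightarrow> nat \<times> nat \<Rightarrow> nat \<times> nat \<Rightarrow> real \<Rightarrow> real" where
  "hmax q s \<alpha> p ij0 ij1 t =
     real_of_ereal (max (h0 q s \<alpha> p ij0 t) (max (h1 s \<alpha> p ij1 t) (h2 q s \<alpha> p t)))"

definition corner_points :: "real \<Rightarrow> (real \<Rightarrow> real) \<Rightarrow> real set" where
  "corner_points q h = {t. 1 < t \<and> t < q/2 \<and> \<not> h differentiable (at t)}"

text \<open>The set of those \<open>l\<close> for which the index \<open>j(l)\<close> is defined.\<close>

definition jdom :: "real \<Rightarrow> nat \<Rightarrow> (nat \<Rightarrow> ereal) \<Rightarrow> nat \<Rightarrow> nat set" where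
  "jdom q s p L = {l. 2 \<le> l \<and> l + 1 \<le> L}
     \<union> (if idxK s p = {} then {1} else {}) \<union> (if idxI q s p = {} then {L} else {})"

end

theory Submission
  imports Defs "HOL-Analysis.Elementary_Metric_Spaces"
begin

text \<open>Consider the points \<open>(1/p\<^sub>j, \<alpha>\<^sub>j)\<close>. By (a) every chord between them has slope in \<open>(0, 1)\<close>, and by
  (d) no three of them are collinear. The pairs \<open>(i\<^sub>0, j\<^sub>0)\<close> and \<open>(i\<^sub>1, j\<^sub>1)\<close> are the edges of their upper
  hull over \<open>1/q\<close> and \<open>1/2\<close>, and \<open>h(t)\<close> is the maximum over the hull restricted to \<open>[1/q, 1/2]\<close> of
  \<open>t (y - \<mu> (x - 1/q))\<close>, where \<open>\<mu> = (t - 1) q / (t (q - 2))\<close> increases from \<open>0\<close> to \<open>1\<close> as \<open>t\<close> runs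
  through \<open>[1, q/2]\<close>. So the maximizer moves from the rightmost vertex to the leftmost one, and the
  corner points are the times at which \<open>\<mu>\<close> equals the slope of an edge. The first and the last edge
  of the restricted hull lie on the two maximal chords, which yields the statements on \<open>i\<^sub>1\<close> and
  \<open>j\<^sub>0\<close>.\<close>

subsection \<open>Maxima of finitely many affine functions\<close>

lemma affine_less_nhds:
  fixes z :: real
  assumes "c + d * z < c' + d' * z"
  shows "\<forall>\<^sub>F y in nhds z. c + d * y < c' + d' * y"
proof -
  have "open {y. c + d * y < c' + d' * y}"
    by (intro open_Collect_less continuous_intros)
  then show ?thesis
    using assms by (auto simp: eventually_nhds)
qed

lemma open_if_eventually: "(\<And>z. z \<in> S \<Longrightarrow> \<forall>\<^sub>F y in nhds z. y \<in> S) \<Longrightarrow> open S"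
  by (subst open_subopen) (metis eventually_nhds subsetI)

locale max_affine =
  fixes N :: "'i set" and a b :: "'i \<Rightarrow> real" and h :: "real \<Rightarrow> real"
  assumes fin: "finite N"
    and upper: "n \<in> N \<Longrightarrow> a n + b n * y \<le> h y"
    and attained: "\<exists>n\<in>N. h y = a n + b n * y"
begin

text \<open>The gap between \<open>h\<close> and an affine function touching it at \<open>z\<close>
  is nonnegative and vanishes there, so \<open>z\<close> minimizes the gap and its derivative is
  zero.\<close>

lemma active_deriv:
  assumes "n \<in> N" "h z = a n + b n * z" "DERIV h z :> D"
  shows "D = b n"
proof -
  have "DERIV (\<lambda>y. h y - (a n + b n * y)) z :> D - b n"
    using assms(3) by (auto intro!: derivative_eq_intros)
  then have "D - b n = 0"
    by (rule DERIV_local_min[where d = 1]) (use assms upper in auto)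
  then show ?thesis by simp
qed

text \<open>Every function active at \<open>z\<close> has the derivative of \<open>h\<close> as its
  slope and so coincides with that of \<open>n\<close>; the finitely many inactive ones stay
  strictly below near \<open>z\<close>.\<close>

lemma locally_affine:
  assumes n: "n \<in> N" "h z = a n + b n * z" and diff: "h differentiable (at z)"
  shows "\<forall>\<^sub>F y in nhds z. h y = a n + b n * y"
proof -
  obtain D where D: "DERIV h z :> D"
    using diff real_differentiable_def by blast
  have "\<forall>\<^sub>F y in nhds z. a k + b k * y \<le> a n + b n * y" if k: "k \<in> N" for k
  proof (cases "h z = a k + b k * z")
    case True
    then have "b k = b n"
      using active_deriv n k D by metis
    then show ?thesis
      using True n by simp
  next
    case False
    then have "\<forall>\<^sub>F y in nhds z. a k + b k * y < a n + b n * y"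
      using upper[OF k, of z] n by (intro affine_less_nhds) simp
    then show ?thesis
      by eventually_elim simp
  qed
  then have "\<forall>\<^sub>F y in nhds z. \<forall>k\<in>N. a k + b k * y \<le> a n + b n * y"
    using fin by (simp add: eventually_ball_finite)
  then show ?thesis
  proof eventually_elim
    case (elim y)
    then show ?case
      using attained[of y] upper[OF n(1), of y] by fastforce
  qed
qed

lemma differentiable_if_locally_affine:
  assumes "\<forall>\<^sub>F y in nhds z. h y = a n + b n * y"
  shows "h differentiable (at z)"
proof -
  have "DERIV (\<lambda>y. a n + b n * y) z :> b n"
    by (auto intro!: derivative_eq_intros)
  then have "DERIV h z :> b n"
    using DERIV_cong_ev[OF refl assms refl] by blast
  then show ?thesis
    using real_differentiable_def by blast
qed

text \<open>The open interval is connected, and both the set where \<open>h\<close> follows the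
  function active at the midpoint and its complement are open by
  \<open>locally_affine\<close>.\<close>

lemma affine_on_interval:
  assumes "u < v" and diff: "\<And>z. u < z \<Longrightarrow> z < v \<Longrightarrow> h differentiable (at z)"
  shows "\<exists>n\<in>N. \<forall>y\<in>{u..v}. h y = a n + b n * y"
proof -
  define m where "m = (u + v) / 2"
  have m: "m \<in> {u<..<v}"
    using assms(1) by (simp add: m_def)
  obtain n where n: "n \<in> N" "h m = a n + b n * m"
    using attained by blast
  let ?f = "\<lambda>y. a n + b n * y"
  let ?U = "{z\<in>{u<..<v}. h z = ?f z}" and ?V = "{z\<in>{u<..<v}. h z \<noteq> ?f z}"
  have "\<forall>\<^sub>F y in nhds z. y \<in> ?U" if z: "z \<in> ?U" for z
  proof -
    have "\<forall>\<^sub>F y in nhds z. h y = ?f y"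
      using locally_affine[OF n(1)] diff z by simp
    moreover have "\<forall>\<^sub>F y in nhds z. y \<in> {u<..<v}"
      using eventually_nhds_in_open[of "{u<..<v}" z] z by simp
    ultimately show ?thesis
      by eventually_elim auto
  qed
  then have U: "open ?U"
    by (rule open_if_eventually)
  have "\<forall>\<^sub>F y in nhds z. y \<in> ?V" if z: "z \<in> ?V" for z
  proof -
    \<comment> \<open>Near \<open>z\<close> the function \<open>h\<close> follows some
      \<open>k\<close> that strictly beats \<open>?f\<close>, so points of \<open>?V\<close> stay in
      \<open>?V\<close>.\<close>
    obtain k where k: "k \<in> N" "h z = a k + b k * z"
      using attained by blast
    have "\<forall>\<^sub>F y in nhds z. ?f y < a k + b k * y"
      using z k upper[OF n(1), of z] by (intro affine_less_nhds) simp
    moreover have "\<forall>\<^sub>F y in nhds z. h y = a k + b k * y"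
      using locally_affine[OF k] diff z by simp
    moreover have "\<forall>\<^sub>F y in nhds z. y \<in> {u<..<v}"
      using eventually_nhds_in_open[of "{u<..<v}" z] z by simp
    ultimately show ?thesis
      by eventually_elim auto
  qed
  then have V: "open ?V"
    by (rule open_if_eventually)
  have "?U \<inter> {u<..<v} = {} \<or> ?V \<inter> {u<..<v} = {}"
    by (rule connectedD[OF connected_Ioo U V]) auto
  then have interior: "h y = ?f y" if "y \<in> {u<..<v}" for y
    using that m n by blast
  have "h y = ?f y" if y: "y \<in> {u..v}" for y
  proof -
    obtain k where k: "k \<in> N" "h y = a k + b k * y"
      using attained by blast
    \<comment> \<open>This covers the endpoints: with \<open>k\<close> active at \<open>y\<close>,
      the difference of the two affine functions is nonnegative inside, hence on the
      closure.\<close>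
    have "0 \<le> ?f y - (a k + b k * y)"
    proof (rule continuous_ge_on_closure[where S = "{u<..<v}" and f = "\<lambda>y. ?f y - (a k + b k * y)"])
      show "continuous_on (closure {u<..<v}) (\<lambda>y. ?f y - (a k + b k * y))"
        by (intro continuous_intros)
      show "y \<in> closure {u<..<v}"
        using y assms(1) by simp
      show "0 \<le> ?f w - (a k + b k * w)" if "w \<in> {u<..<v}" for w
        using interior[OF that] upper[OF k(1), of w] by simp
    qed
    then show ?thesis
      using k upper[OF n(1), of y] by simp
  qed
  then show ?thesis
    using n(1) by blast
qed

end

section \<open>Corner points and the affine pieces between them\<close>

locale max_affine_corners = max_affine +
  fixes lo hi :: real and L :: nat and t :: "nat \<Rightarrow> real"
  assumes L: "1 \<le> L"
    and ends: "t 0 = lo" "t L = hi"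
    and t_mono: "strict_mono_on {0..L} t"
    and corners: "t ` {1..<L} = {z. lo < z \<and> z < hi \<and> \<not> h differentiable (at z)}"
begin

lemma t_less: "k < l \<Longrightarrow> l \<le> L \<Longrightarrow> t k < t l"
  using t_mono by (auto simp: strict_mono_on_def)

lemma t_less_iff: "k \<le> L \<Longrightarrow> l \<le> L \<Longrightarrow> t k < t l \<longleftrightarrow> k < l"
  using t_less[of k l] t_less[of l k] by (cases k l rule: linorder_cases) auto

text \<open>The corner points are listed in increasing order, so none falls strictly between two
  neighbours.\<close>

lemma piece_exists:
  assumes "l \<in> {1..L}"
  shows "\<exists>n\<in>N. \<forall>y\<in>{t (l - 1)..t l}. h y = a n + b n * y"
proof (rule affine_on_interval)
  have l: "1 \<le> l" "l \<le> L" "l - 1 \<le> L"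
    using assms by auto
  show "t (l - 1) < t l"
    using assms by (intro t_less) auto
  fix z assume z: "t (l - 1) < z" "z < t l"
  have "lo \<le> t (l - 1)"
    using ends t_less[of 0 "l - 1"] l by (cases "l = 1") auto
  then have "lo < z"
    using z(1) by simp
  moreover have "t l \<le> hi"
    using ends t_less[of l L] l by (cases "l = L") auto
  then have "z < hi"
    using z(2) by simp
  moreover have "z \<notin> t ` {1..<L}"
  proof
    assume "z \<in> t ` {1..<L}"
    then obtain k where "k \<in> {1..<L}" "z = t k"
      by blast
    then have "l - 1 < k" "k < l"
      using z t_less_iff[of "l - 1" k] t_less_iff[of k l] l by simp_all
    then show False
      by simp
  qed
  ultimately show "h differentiable (at z)"
    using corners by blast
qed

end

text \<open>Piece \<open>l\<close> runs from \<open>t (l - 1)\<close> to \<open>t l\<close>; the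
  index \<open>g l\<close> carrying it will serve as j(l).\<close>

locale pieces = max_affine_corners +
  fixes g :: "nat \<Rightarrow> 'a"
  assumes g_node: "l \<in> {1..L} \<Longrightarrow> g l \<in> N"
    and g_eq: "l \<in> {1..L} \<Longrightarrow> y \<in> {t (l - 1)..t l} \<Longrightarrow> h y = a (g l) + b (g l) * y"
begin

lemma h_left: "l \<in> {1..L} \<Longrightarrow> h (t (l - 1)) = a (g l) + b (g l) * t (l - 1)"
  using t_less[of "l - 1" l] by (intro g_eq) auto

lemma h_right: "l \<in> {1..L} \<Longrightarrow> h (t l) = a (g l) + b (g l) * t l"
  using t_less[of "l - 1" l] by (intro g_eq) auto

text \<open>The two functions agree at \<open>t l\<close> and the later one dominates at
  \<open>t (Suc l)\<close>, so the slope does not drop. Equal slopes would make \<open>h\<close>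
  affine around \<open>t l\<close>, which is a corner point.\<close>

lemma slope_step:
  assumes l: "1 \<le> l" "l < L"
  shows "b (g l) < b (g (Suc l))"
proof -
  let ?m = "g l" and ?n = "g (Suc l)"
  have less: "t (l - 1) < t l" "t l < t (Suc l)"
    using t_less[of "l - 1" l] t_less[of l "Suc l"] l by auto
  have eq: "a ?m + b ?m * t l = a ?n + b ?n * t l"
    using h_right[of l] h_left[of "Suc l"] l by simp
  have "a ?m + b ?m * t (Suc l) \<le> a ?n + b ?n * t (Suc l)"
    using h_right[of "Suc l"] upper[OF g_node, of l "t (Suc l)"] l by simp
  then have "0 \<le> (b ?n - b ?m) * (t (Suc l) - t l)"
    using eq by (simp add: algebra_simps)
  then have "b ?m \<le> b ?n"
    using less by (simp add: zero_le_mult_iff)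
  moreover have "b ?m \<noteq> b ?n"
  proof
    assume same: "b ?m = b ?n"
    have "\<forall>\<^sub>F y in nhds (t l). y \<in> {t (l - 1)<..<t (Suc l)}"
      using less by (intro eventually_nhds_in_open) auto
    then have "\<forall>\<^sub>F y in nhds (t l). h y = a ?m + b ?m * y"
    proof eventually_elim
      case (elim y)
      then show ?case
        using g_eq[of l y] g_eq[of "Suc l" y] l eq same by (cases "y \<le> t l") auto
    qed
    then have "h differentiable (at (t l))"
      by (rule differentiable_if_locally_affine)
    moreover have "t l \<in> t ` {1..<L}"
      using l by auto
    ultimately show False
      using corners by blast
  qed
  ultimately show ?thesis by simp
qed

lemma slope_less:
  assumes "1 \<le> k" "k < l" "l \<le> L"
  shows "b (g k) < b (g l)"
  using assms(2,3)
proof (induction l rule: less_induct)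
  case (less l)
  then obtain l' where l': "l = Suc l'"
    by (cases l) auto
  show ?case
  proof (cases "k = l'")
    case True
    then show ?thesis
      using slope_step[of k] less.prems assms(1) l' by simp
  next
    case False
    then have "b (g k) < b (g l')"
      using less.IH[of l'] less.prems l' by simp
    also have "\<dots> < b (g l)"
      using slope_step[of l'] less.prems assms(1) l' by simp
    finally show ?thesis .
  qed
qed

text \<open>Slopes increase strictly from piece to piece, so no node carries two of them.\<close>

lemma g_inj:
  assumes "k \<in> {1..L}" "l \<in> {1..L}" "g k = g l"
  shows "k = l"
  using assms slope_less[of k l] slope_less[of l k] by (cases k l rule: linorder_cases) auto

lemma first_piece:
  assumes "\<And>n. n \<in> N - {m} \<Longrightarrow> a n + b n * lo < a m + b m * lo" "m \<in> N"
  shows "g 1 = m"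
proof (rule ccontr)
  assume "g 1 \<noteq> m"
  then show False
    using assms(1)[of "g 1"] g_node[of 1] h_left[of 1] ends L upper[OF assms(2), of lo] by auto
qed

lemma last_piece:
  assumes "\<And>n. n \<in> N - {m} \<Longrightarrow> a n + b n * hi < a m + b m * hi" "m \<in> N"
  shows "g L = m"
proof (rule ccontr)
  assume "g L \<noteq> m"
  then show False
    using assms(1)[of "g L"] g_node[of L] h_right[of L] ends L upper[OF assms(2), of hi] by auto
qed

text \<open>Two functions of different slope that tie above all others produce a kink, so
  \<open>\<tau>\<close> is one of the \<open>t l\<close>. The two adjacent pieces must be carried by
  \<open>n\<close> and \<open>m\<close>, and increasing slopes put \<open>n\<close> first.\<close>

lemma crossing:
  assumes mn: "m \<in> N" "n \<in> N" "b n < b m" and \<tau>: "lo < \<tau>" "\<tau> < hi"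
    and eq: "a m + b m * \<tau> = a n + b n * \<tau>"
    and less: "\<And>k. k \<in> N - {m, n} \<Longrightarrow> a k + b k * \<tau> < a n + b n * \<tau>"
  shows "\<exists>l. 1 \<le> l \<and> l < L \<and> g l = n \<and> g (Suc l) = m"
proof -
  have h\<tau>: "h \<tau> = a n + b n * \<tau>"
    using attained[of \<tau>] upper[OF mn(2), of \<tau>] less eq by force
  have "\<not> h differentiable (at \<tau>)"
  proof
    assume "h differentiable (at \<tau>)"
    then obtain D where "DERIV h \<tau> :> D"
      using real_differentiable_def by blast
    then have "D = b m" "D = b n"
      using active_deriv[of m \<tau> D] active_deriv[of n \<tau> D] mn h\<tau> eq by auto
    then show False
      using mn(3) by simp
  qed
  then obtain l where l: "l \<in> {1..<L}" "\<tau> = t l"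
    using \<tau> corners by blast
  have "g l \<in> {m, n}"
    using g_node[of l] h_right[of l] l h\<tau> less[of "g l"] by fastforce
  moreover have "g (Suc l) \<in> {m, n}"
    using g_node[of "Suc l"] h_left[of "Suc l"] l h\<tau> less[of "g (Suc l)"] by fastforce
  moreover have "b (g l) < b (g (Suc l))"
    using slope_step l by simp
  ultimately have "g l = n \<and> g (Suc l) = m"
    using mn(3) by auto
  then show ?thesis
    using l by auto
qed

end

subsection \<open>Maximal chords\<close>

text \<open>Point-slope form of the line through two points. It is also evaluated outside the
  segment, for instance when hull points are compared with a maximal chord.\<close>

definition chord :: "(nat \<Rightarrow> real) \<Rightarrow> (nat \<Rightarrow> real) \<Rightarrow> nat \<Rightarrow> nat \<Rightarrow> real \<Rightarrow> real" where
  "chord x \<alpha> i j c = \<alpha> i + (\<alpha> j - \<alpha> i) / (x j - x i) * (c - x i)"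

lemma chord_left [simp]: "chord x \<alpha> i j (x i) = \<alpha> i"
  by (simp add: chord_def)

lemma chord_right [simp]: "x i \<noteq> x j \<Longrightarrow> chord x \<alpha> i j (x j) = \<alpha> j"
  by (simp add: chord_def)

lemma chord_diff: "chord x \<alpha> i j c - chord x \<alpha> i j d = (\<alpha> j - \<alpha> i) / (x j - x i) * (c - d)"
  unfolding chord_def right_diff_distrib by simp

text \<open>Linear interpolation commutes with subtracting an affine function: the difference at
  \<open>c\<close> is the mean of the differences at the two ends, with weights proportional to
  \<open>x l - c\<close> and \<open>c - x k\<close>.\<close>

lemma chord_minus_affine:
  assumes "x k < x l"
  shows "chord x \<alpha> k l c - (\<beta> + m * c) =
    ((x l - c) * (\<alpha> k - (\<beta> + m * x k)) + (c - x k) * (\<alpha> l - (\<beta> + m * x l))) / (x l - x k)"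
proof -
  have "chord x \<alpha> k l c * (x l - x k) = \<alpha> k * (x l - x k) + (\<alpha> l - \<alpha> k) * (c - x k)"
    using assms by (simp add: chord_def distrib_right)
  then have "(chord x \<alpha> k l c - (\<beta> + m * c)) * (x l - x k) =
      (x l - c) * (\<alpha> k - (\<beta> + m * x k)) + (c - x k) * (\<alpha> l - (\<beta> + m * x l))"
    by (simp add: left_diff_distrib) (simp add: algebra_simps)
  then show ?thesis
    using assms by (simp add: eq_divide_eq)
qed

lemma chord_le_affine:
  assumes "x k < c" "c < x l" "\<alpha> k \<le> \<beta> + m * x k" "\<alpha> l \<le> \<beta> + m * x l"
  shows "chord x \<alpha> k l c \<le> \<beta> + m * c"
proof -
  have "(x l - c) * (\<alpha> k - (\<beta> + m * x k)) \<le> 0" "(c - x k) * (\<alpha> l - (\<beta> + m * x l)) \<le> 0"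
    using assms by (simp_all add: mult_nonneg_nonpos)
  then have "chord x \<alpha> k l c - (\<beta> + m * c) \<le> 0"
    using assms by (subst chord_minus_affine) (auto intro!: divide_nonpos_pos)
  then show ?thesis by simp
qed

lemma chord_less_affine:
  assumes "x k < c" "c < x l" "\<alpha> k \<le> \<beta> + m * x k" "\<alpha> l \<le> \<beta> + m * x l"
    and "\<alpha> k < \<beta> + m * x k \<or> \<alpha> l < \<beta> + m * x l"
  shows "chord x \<alpha> k l c < \<beta> + m * c"
proof -
  have "(x l - c) * (\<alpha> k - (\<beta> + m * x k)) \<le> 0" "(c - x k) * (\<alpha> l - (\<beta> + m * x l)) \<le> 0"
    using assms by (simp_all add: mult_nonneg_nonpos)
  moreover have "(x l - c) * (\<alpha> k - (\<beta> + m * x k)) < 0 \<or> (c - x k) * (\<alpha> l - (\<beta> + m * x l)) < 0"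
    using assms by (auto simp: mult_less_0_iff)
  ultimately have "(x l - c) * (\<alpha> k - (\<beta> + m * x k)) + (c - x k) * (\<alpha> l - (\<beta> + m * x l)) < 0"
    by linarith
  then have "chord x \<alpha> k l c - (\<beta> + m * c) < 0"
    using assms by (subst chord_minus_affine) (auto intro!: divide_neg_pos)
  then show ?thesis by simp
qed

lemma chord_as_affine:
  "chord x \<alpha> i j c = (\<alpha> i - (\<alpha> j - \<alpha> i) / (x j - x i) * x i) + (\<alpha> j - \<alpha> i) / (x j - x i) * c"
  by (simp add: chord_def right_diff_distrib)

lemma chord_le_chord:
  assumes "x k < c" "c < x l" "\<alpha> k \<le> chord x \<alpha> i j (x k)" "\<alpha> l \<le> chord x \<alpha> i j (x l)"
  shows "chord x \<alpha> k l c \<le> chord x \<alpha> i j c"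
  using assms unfolding chord_as_affine[of x \<alpha> i j] by (rule chord_le_affine)

lemma chord_less_chord:
  assumes "x k < c" "c < x l" "\<alpha> k \<le> chord x \<alpha> i j (x k)" "\<alpha> l \<le> chord x \<alpha> i j (x l)"
    and "\<alpha> k < chord x \<alpha> i j (x k) \<or> \<alpha> l < chord x \<alpha> i j (x l)"
  shows "chord x \<alpha> k l c < chord x \<alpha> i j c"
  using assms unfolding chord_as_affine[of x \<alpha> i j] by (rule chord_less_affine)

text \<open>This is \<open>chord_less_chord\<close> after the reflection of \<open>\<alpha>\<close>
  to \<open>- \<alpha>\<close>.\<close>

lemma chord_gt_chord:
  assumes "x k < c" "c < x l" "chord x \<alpha> i j (x k) \<le> \<alpha> k" "chord x \<alpha> i j (x l) \<le> \<alpha> l"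
    and "chord x \<alpha> i j (x k) < \<alpha> k \<or> chord x \<alpha> i j (x l) < \<alpha> l"
  shows "chord x \<alpha> i j c < chord x \<alpha> k l c"
proof -
  have neg: "chord x (\<lambda>n. - \<alpha> n) i j c = - chord x \<alpha> i j c" for i j c
    by (simp only: chord_def minus_diff_minus divide_minus_left mult_minus_left minus_add_distrib)
  show ?thesis
    using chord_less_chord[of x k c l "\<lambda>n. - \<alpha> n" i j] assms by (simp add: neg)
qed

text \<open>Here \<open>x j\<close> stands for 1/p_j, so the order relations to \<open>q\<close> and
  2 are reversed. Condition (d) enters as: no third point lies on the line through two
  others.\<close>

locale exponents =
  fixes q :: real and s :: nat and \<alpha> x :: "nat \<Rightarrow> real"
  assumes q: "2 < q"
    and \<alpha>_less: "\<And>i j. i \<in> {1..s} \<Longrightarrow> j \<in> {1..s} \<Longrightarrow> i < j \<Longrightarrow> \<alpha> i < \<alpha> j"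
    and \<alpha>_minus_x_less: "\<And>i j. i \<in> {1..s} \<Longrightarrow> j \<in> {1..s} \<Longrightarrow> i < j \<Longrightarrow> \<alpha> j - x j < \<alpha> i - x i"
    and x_ne: "\<And>j. j \<in> {1..s} \<Longrightarrow> x j \<noteq> 1 / q \<and> x j \<noteq> 1 / 2"
    and not_collinear: "\<And>i j k. i \<in> {1..s} \<Longrightarrow> j \<in> {1..s} \<Longrightarrow> k \<in> {1..s} \<Longrightarrow>
          x i < x j \<Longrightarrow> k \<noteq> i \<Longrightarrow> k \<noteq> j \<Longrightarrow> \<alpha> k \<noteq> chord x \<alpha> i j (x k)"
    and ex_gt: "\<exists>j\<in>{1..s}. 1 / q < x j"
    and ex_lt: "\<exists>j\<in>{1..s}. x j < 1 / 2"
begin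

lemma x_less: "i \<in> {1..s} \<Longrightarrow> j \<in> {1..s} \<Longrightarrow> i < j \<Longrightarrow> x i < x j"
  using \<alpha>_less[of i j] \<alpha>_minus_x_less[of i j] by simp

lemma x_less_iff: "i \<in> {1..s} \<Longrightarrow> j \<in> {1..s} \<Longrightarrow> x i < x j \<longleftrightarrow> i < j"
  using x_less[of i j] x_less[of j i] by (cases i j rule: linorder_cases) auto

text \<open>For \<open>c\<close> equal to 1/q or 1/2 the pair is the edge of the upper hull over
  \<open>c\<close>; the competitors are all chords that straddle \<open>c\<close>.\<close>

definition maximal_chord :: "real \<Rightarrow> nat \<Rightarrow> nat \<Rightarrow> bool" where
  "maximal_chord c i j \<longleftrightarrow> i \<in> {1..s} \<and> j \<in> {1..s} \<and> x i < c \<and> c < x j \<and>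
     (\<forall>k\<in>{1..s}. \<forall>l\<in>{1..s}. x k < c \<longrightarrow> c < x l \<longrightarrow> chord x \<alpha> k l c \<le> chord x \<alpha> i j c)"

text \<open>With growing index \<open>\<alpha>\<close> rises while \<open>\<alpha> - x\<close>
  falls, so a chord goes up, but by less than its horizontal extent.\<close>

lemma slope_bounds:
  assumes "i \<in> {1..s}" "j \<in> {1..s}" "x i < x j"
  shows "0 < (\<alpha> j - \<alpha> i) / (x j - x i)" "(\<alpha> j - \<alpha> i) / (x j - x i) < 1"
proof -
  have "i < j"
    using assms x_less_iff by blast
  then show "0 < (\<alpha> j - \<alpha> i) / (x j - x i)" "(\<alpha> j - \<alpha> i) / (x j - x i) < 1"
    using assms \<alpha>_less[of i j] \<alpha>_minus_x_less[of i j] by simp_all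
qed

text \<open>A point above the line could replace whichever of \<open>i\<close>, \<open>j\<close>
  lies on its side of \<open>c\<close>, giving a higher chord over \<open>c\<close>; a point on the
  line is excluded by \<open>not_collinear\<close>.\<close>

lemma maximal_chord_above:
  assumes max: "maximal_chord c i j" and k: "k \<in> {1..s}" "k \<noteq> i" "k \<noteq> j" "x k \<noteq> c"
  shows "\<alpha> k < chord x \<alpha> i j (x k)"
proof (rule ccontr)
  assume "\<not> ?thesis"
  moreover have "\<alpha> k \<noteq> chord x \<alpha> i j (x k)"
    using max k by (intro not_collinear) (auto simp: maximal_chord_def)
  ultimately have gt: "chord x \<alpha> i j (x k) < \<alpha> k"
    by simp
  have "x i < c" "c < x j"
    using max by (auto simp: maximal_chord_def)
  then consider "x k < c" "chord x \<alpha> i j c < chord x \<alpha> k j c"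
    | "c < x k" "chord x \<alpha> i j c < chord x \<alpha> i k c"
    using k gt chord_gt_chord[of x k c j \<alpha> i j] chord_gt_chord[of x i c k \<alpha> i j]
    by (cases "x k" c rule: linorder_cases) auto
  then show False
    using max k by cases (force simp: maximal_chord_def)+
qed

lemma maximal_chord_ge:
  assumes "maximal_chord c i j" "k \<in> {1..s}" "x k \<noteq> c"
  shows "\<alpha> k \<le> chord x \<alpha> i j (x k)"
  using maximal_chord_above[OF assms(1,2)] assms
  by (cases "k \<in> {i, j}") (auto simp: maximal_chord_def less_le)

lemma maximal_chord_ge_chord:
  assumes max: "maximal_chord c i j" and c: "\<And>k. k \<in> {1..s} \<Longrightarrow> x k \<noteq> c"
    and kl: "k \<in> {1..s}" "l \<in> {1..s}" "x k < d" "d < x l"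
  shows "chord x \<alpha> k l d \<le> chord x \<alpha> i j d"
  using maximal_chord_ge[OF max] c kl by (intro chord_le_chord) auto

text \<open>Equality at any abscissa \<open>d\<close> between the ends forces both ends onto the
  line, where \<open>i\<close> and \<open>j\<close> are the only points; the order of
  \<open>x\<close> tells which is which.\<close>

lemma maximal_chord_eq:
  assumes max: "maximal_chord c i j" and c: "\<And>k. k \<in> {1..s} \<Longrightarrow> x k \<noteq> c"
    and kl: "k \<in> {1..s}" "l \<in> {1..s}" "x k < d" "d < x l"
    and eq: "chord x \<alpha> k l d = chord x \<alpha> i j d"
  shows "k = i" "l = j"
proof -
  have "\<not> \<alpha> k < chord x \<alpha> i j (x k)" "\<not> \<alpha> l < chord x \<alpha> i j (x l)"
    using chord_less_chord[of x k d l \<alpha> i j] maximal_chord_ge[OF max] c kl eq by fastforce+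
  then have "k \<in> {i, j}" "l \<in> {i, j}"
    using maximal_chord_above[OF max] c kl by blast+
  moreover have "x i < x j"
    using max by (auto simp: maximal_chord_def)
  ultimately show "k = i" "l = j"
    using kl by auto
qed

end

subsection \<open>Vertices of the restricted hull\<close>

locale chord_maximizers = exponents +
  fixes i0 j0 i1 j1 :: nat and I J K :: "nat set"
  assumes I: "I = {j \<in> {1..s}. x j < 1 / q}"
    and J: "J = {j \<in> {1..s}. 1 / q < x j \<and> x j < 1 / 2}"
    and K: "K = {j \<in> {1..s}. 1 / 2 < x j}"
    and max0: "I \<noteq> {} \<Longrightarrow> maximal_chord (1 / q) i0 j0"
    and max1: "K \<noteq> {} \<Longrightarrow> maximal_chord (1 / 2) i1 j1"
begin

text \<open>The candidate vertices of the upper hull over \<open>[1/q, 1/2]\<close>: a node \<open>j \<in> J\<close> is the point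
  \<open>(1/p\<^sub>j, \<alpha>\<^sub>j)\<close>, while \<open>0\<close> and \<open>Suc s\<close> stand for the points of the hull on the lines \<open>1/q\<close> and
  \<open>1/2\<close>. With this numbering \<open>h\<^sub>0\<close>, \<open>h\<^sub>1\<close> and the \<open>\<phi>\<^sub>j\<close> are all the affine function
  \<open>t \<mapsto> intercept n + slope n * t\<close> of a node.\<close>

definition N :: "nat set" where
  "N = J \<union> (if I = {} then {} else {0}) \<union> (if K = {} then {} else {Suc s})"

definition X :: "nat \<Rightarrow> real" where
  "X n = (if n = 0 then 1 / q else if n = Suc s then 1 / 2 else x n)"

definition Y :: "nat \<Rightarrow> real" where
  "Y n = (if n = 0 then chord x \<alpha> i0 j0 (1 / q)
          else if n = Suc s then chord x \<alpha> i1 j1 (1 / 2) else \<alpha> n)"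

definition intercept :: "nat \<Rightarrow> real" where
  "intercept n = 1/2 * ((X n - 1/q) / (1/2 - 1/q))"

definition slope :: "nat \<Rightarrow> real" where
  "slope n = Y n - intercept n"

lemma JD: "n \<in> J \<Longrightarrow> n \<in> {1..s}" "n \<in> J \<Longrightarrow> X n = x n" "n \<in> J \<Longrightarrow> Y n = \<alpha> n"
  by (auto simp: J X_def Y_def)

lemma finite_N: "finite N"
proof -
  have "finite J"
    by (simp add: J)
  then show ?thesis
    by (simp add: N_def)
qed

lemma N_cases:
  assumes "n \<in> N"
  obtains "n \<in> J" | "n = 0" "I \<noteq> {}" | "n = Suc s" "K \<noteq> {}"
  using assms by (auto simp: N_def split: if_splits)

lemma J_in_N: "n \<in> J \<Longrightarrow> n \<in> N"
  by (simp add: N_def)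

lemma ends_in_N: "I \<noteq> {} \<Longrightarrow> 0 \<in> N" "K \<noteq> {} \<Longrightarrow> Suc s \<in> N"
  by (simp_all add: N_def)

lemma ends_notin_J: "0 \<notin> J" "Suc s \<notin> J"
  using JD(1)[of 0] JD(1)[of "Suc s"] by auto

lemma ends_coordinates:
  "X 0 = 1 / q" "X (Suc s) = 1 / 2"
  "Y 0 = chord x \<alpha> i0 j0 (1 / q)" "Y (Suc s) = chord x \<alpha> i1 j1 (1 / 2)"
  by (simp_all add: X_def Y_def)

lemma intercept_0 [simp]: "intercept 0 = 0"
  by (simp add: intercept_def X_def)

lemma intercept_Suc [simp]: "intercept (Suc s) = 1 / 2"
  using q by (simp add: intercept_def X_def field_simps)

lemma intercept_eq: "intercept n = (X n - 1 / q) * (q / (q - 2))"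
  using q by (simp add: intercept_def field_simps)

lemma value_1: "intercept n + slope n * 1 = Y n"
  by (simp add: slope_def)

text \<open>At \<open>t = 1\<close> the nodes are ranked by \<open>Y\<close>, at
  \<open>t = q/2\<close> by \<open>Y - X\<close>: the limiting cases of lines of slope 0 and
  1.\<close>

lemma value_half: "intercept n + slope n * (q / 2) = q / 2 * (Y n - X n) + 1 / 2"
  using q by (simp add: slope_def intercept_eq divide_simps) (simp add: algebra_simps)

text \<open>At the time \<open>\<tau>\<close> the value of a node depends only on the height at which the line of slope
  \<open>m\<close> through it meets the line \<open>1/q\<close>.\<close>

lemma value_slope:
  assumes "0 < m" "m < 1"
  shows "\<exists>\<tau>. 1 < \<tau> \<and> \<tau> < q / 2 \<and> (\<forall>n. intercept n + slope n * \<tau> = \<tau> * (Y n - m * (X n - 1 / q)))"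
proof -
  \<comment> \<open>The time \<open>q / e\<close> is the solution \<open>\<tau>\<close> of
    \<open>m = (\<tau> - 1) * q / (\<tau> * (q - 2))\<close>.\<close>
  define e where "e = q - m * (q - 2)"
  have "0 < m * (q - 2)" "0 < (1 - m) * (q - 2)"
    using assms q by simp_all
  then have e: "2 < e" "e < q"
    by (simp_all add: e_def algebra_simps)
  have "intercept n + slope n * (q / e) = q / e * (Y n - m * (X n - 1 / q))" for n
  proof -
    have "intercept n + slope n * (q / e) = q / e * Y n + (e - q) / e * intercept n"
      using e by (simp add: slope_def field_simps)
    also have "(e - q) / e * intercept n = - (q / e * (m * (X n - 1 / q)))"
      using q e by (simp add: intercept_eq e_def)
    finally show ?thesis
      by (simp add: algebra_simps)
  qed
  moreover have "1 < q / e" "q / e < q / 2"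
    using e q by (simp_all add: divide_simps)
  ultimately show ?thesis by blast
qed

text \<open>The intercept grows by the factor \<open>q / (q - 2) > 1\<close> times the gap in
  \<open>x\<close>, which outweighs the growth of \<open>\<alpha>\<close>, smaller than that
  gap.\<close>

lemma slope_less_J:
  assumes "j \<in> J" "k \<in> J" "j < k"
  shows "slope k < slope j"
proof -
  have "intercept k - intercept j = (x k - x j) * (q / (q - 2))"
    using assms by (simp add: intercept_eq JD algebra_simps flip: diff_divide_distrib)
  also have "\<dots> > x k - x j"
    using x_less[of j k] assms q JD by (simp add: field_simps)
  finally show ?thesis
    using \<alpha>_minus_x_less[of j k] assms JD by (simp add: slope_def)
qed

text \<open>Nodes of \<open>J\<close> are covered by \<open>maximal_chord_above\<close>. The nodes
  \<open>0\<close> and \<open>Suc s\<close> are heights of chords across 1/q and 1/2, so they are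
  bounded by \<open>maximal_chord_ge_chord\<close>, and by \<open>maximal_chord_eq\<close> equality
  means that the chords are the same.\<close>

lemma node_below:
  assumes max: "maximal_chord c i j" and c: "c \<in> {1 / q, 1 / 2}" and n: "n \<in> N"
  shows "Y n < chord x \<alpha> i j (X n) \<or> Y n = chord x \<alpha> i j (X n) \<and>
    (n \<in> J \<inter> {i, j} \<or> n = 0 \<and> i0 = i \<and> j0 = j \<or> n = Suc s \<and> i1 = i \<and> j1 = j)"
proof -
  have ne: "\<And>k. k \<in> {1..s} \<Longrightarrow> x k \<noteq> c"
    using x_ne c by blast
  from n show ?thesis
  proof (cases rule: N_cases)
    case 1
    have "x i \<noteq> x j"
      using max by (auto simp: maximal_chord_def)
    then show ?thesis
      using maximal_chord_above[OF max, of n] ne[of n] JD[OF 1] 1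
      by (cases "n \<in> {i, j}") auto
  next
    case 2
    then have kl: "i0 \<in> {1..s}" "j0 \<in> {1..s}" "x i0 < 1 / q" "1 / q < x j0"
      using max0 by (simp_all add: maximal_chord_def)
    show ?thesis
      using maximal_chord_ge_chord[OF max ne kl] maximal_chord_eq[OF max ne kl] 2
      by (auto simp: X_def Y_def)
  next
    case 3
    then have kl: "i1 \<in> {1..s}" "j1 \<in> {1..s}" "x i1 < 1 / 2" "1 / 2 < x j1"
      using max1 by (simp_all add: maximal_chord_def)
    show ?thesis
      using maximal_chord_ge_chord[OF max ne kl] maximal_chord_eq[OF max ne kl] 3
      by (auto simp: X_def Y_def)
  qed
qed

text \<open>At the time belonging to the slope of the chord, the nodes on its line tie and those
  below it are strictly smaller. Since \<open>u\<close> is lower than \<open>v\<close> at time 1 and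
  has caught up at \<open>\<tau>\<close>, its slope is larger.\<close>

lemma edge:
  assumes max: "maximal_chord c i j" and c: "c \<in> {1 / q, 1 / 2}" and uv: "u \<in> N" "v \<in> N" "X u < X v"
    and on: "Y u = chord x \<alpha> i j (X u)" "Y v = chord x \<alpha> i j (X v)"
    and below: "\<And>n. n \<in> N \<Longrightarrow> n \<noteq> u \<Longrightarrow> n \<noteq> v \<Longrightarrow> Y n < chord x \<alpha> i j (X n)"
  shows "\<exists>\<tau>. 1 < \<tau> \<and> \<tau> < q / 2 \<and> slope v < slope u \<and> intercept u + slope u * \<tau> = intercept v + slope v * \<tau> \<and>
    (\<forall>n\<in>N - {u, v}. intercept n + slope n * \<tau> < intercept v + slope v * \<tau>)"
proof -
  define m where "m = (\<alpha> j - \<alpha> i) / (x j - x i)"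
  have m: "0 < m" "m < 1"
    using max slope_bounds[of i j] by (auto simp: m_def maximal_chord_def)
  then obtain \<tau> where \<tau>: "1 < \<tau>" "\<tau> < q / 2"
    and val: "\<And>n. intercept n + slope n * \<tau> = \<tau> * (Y n - m * (X n - 1 / q))"
    using value_slope by blast
  have line: "chord x \<alpha> i j d = chord x \<alpha> i j (1 / q) + m * (d - 1 / q)" for d
    using chord_diff[of x \<alpha> i j d "1 / q"] by (simp add: m_def)
  have eq: "intercept n + slope n * \<tau> = \<tau> * chord x \<alpha> i j (1 / q)" if "n = u \<or> n = v" for n
    using that on line[of "X n"] by (auto simp: val)
  have less: "intercept n + slope n * \<tau> < \<tau> * chord x \<alpha> i j (1 / q)" if "n \<in> N - {u, v}" for n
    using that below[of n] line[of "X n"] \<tau> by (simp add: val)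
  have "Y u < Y v"
    using on uv(3) m line[of "X u"] line[of "X v"] by simp
  then have "0 < (slope u - slope v) * (\<tau> - 1)"
    using eq[of u] eq[of v] value_1[of u] value_1[of v] by (simp add: algebra_simps)
  then have "slope v < slope u"
    using \<tau> by (simp add: zero_less_mult_iff)
  then show ?thesis
    using \<tau> eq[of u] eq[of v] less by (intro exI[of _ \<tau>]) auto
qed

text \<open>The chord over 1/2 rises, and all other nodes lie to the left of 1/2 and on or below its
  line.\<close>

lemma top_node:
  assumes "K \<noteq> {}" "n \<in> N" "n \<noteq> Suc s"
  shows "Y n < Y (Suc s)"
proof -
  have max: "maximal_chord (1 / 2) i1 j1"
    using max1 assms by blast
  have "X n < 1 / 2"
    using assms(2,3) q by (cases rule: N_cases) (auto simp: X_def J field_simps)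
  moreover have "0 < (\<alpha> j1 - \<alpha> i1) / (x j1 - x i1)"
    using max by (intro slope_bounds) (auto simp: maximal_chord_def)
  ultimately have "0 < (\<alpha> j1 - \<alpha> i1) / (x j1 - x i1) * (1 / 2 - X n)"
    by (intro mult_pos_pos) simp_all
  then have "chord x \<alpha> i1 j1 (X n) < Y (Suc s)"
    using chord_diff[of x \<alpha> i1 j1 "1 / 2" "X n"] by (simp add: Y_def)
  then show ?thesis
    using node_below[OF max _ assms(2)] by auto
qed

text \<open>The chord over 1/q has slope below 1, so its height minus the abscissa falls to the
  right of 1/q, where all other nodes lie.\<close>

lemma bottom_node:
  assumes "I \<noteq> {}" "n \<in> N" "n \<noteq> 0"
  shows "Y n - X n < Y 0 - X 0"
proof -
  have max: "maximal_chord (1 / q) i0 j0"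
    using max0 assms by blast
  have "1 / q < X n"
    using assms(2,3) q by (cases rule: N_cases) (auto simp: X_def J field_simps)
  moreover have "(\<alpha> j0 - \<alpha> i0) / (x j0 - x i0) < 1"
    using max by (intro slope_bounds) (auto simp: maximal_chord_def)
  ultimately have "(\<alpha> j0 - \<alpha> i0) / (x j0 - x i0) * (X n - 1 / q) < 1 * (X n - 1 / q)"
    by (intro mult_strict_right_mono) simp_all
  then have "chord x \<alpha> i0 j0 (X n) - X n < Y 0 - X 0"
    using chord_diff[of x \<alpha> i0 j0 "X n" "1 / q"] by (simp add: Y_def X_def)
  then show ?thesis
    using node_below[OF max _ assms(2)] by auto
qed

text \<open>Some point lies right of 1/q, hence so does the last one, and with \<open>K\<close>
  empty it is in \<open>J\<close>. Node \<open>0\<close> is a mean of two heights, neither exceeding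
  \<open>\<alpha> s\<close> and one strictly smaller.\<close>

lemma top_node_J:
  assumes "K = {}"
  shows "s \<in> J" "\<And>n. n \<in> N \<Longrightarrow> n \<noteq> s \<Longrightarrow> Y n < Y s"
proof -
  obtain j where j: "j \<in> {1..s}" "1 / q < x j"
    using ex_gt by blast
  have s: "s \<in> {1..s}" "1 / q < x s"
    using j x_less[of j s] by (cases "j = s"; force)+
  then show "s \<in> J"
    using assms x_ne[of s] by (auto simp: J K)
  then have Ys: "Y s = \<alpha> s"
    by (rule JD)
  fix n assume n: "n \<in> N" "n \<noteq> s"
  from n(1) show "Y n < Y s"
  proof (cases rule: N_cases)
    case 1
    then show ?thesis
      using \<alpha>_less[of n s] n JD[of n] s Ys by simp
  next
    case 2
    then have ij: "i0 \<in> {1..s}" "j0 \<in> {1..s}" "x i0 < 1 / q" "1 / q < x j0"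
      using max0 by (auto simp: maximal_chord_def)
    then have "i0 < j0"
      using x_less_iff[of i0 j0] by simp
    then have "\<alpha> i0 < \<alpha> s" "\<alpha> j0 \<le> \<alpha> s"
      using ij s \<alpha>_less[of i0 s] \<alpha>_less[of j0 s] by (cases "j0 = s"; simp)+
    \<comment> \<open>The comparison line is horizontal at height \<open>\<alpha> s\<close>; the
      factor 0 is its slope.\<close>
    then have "chord x \<alpha> i0 j0 (1 / q) < \<alpha> s + 0 * (1 / q)"
      using ij by (intro chord_less_affine) auto
    then show ?thesis
      using 2 Ys by (simp add: Y_def)
  next
    case 3
    then show ?thesis
      using assms by simp
  qed
qed

text \<open>Mirror image of \<open>top_node_J\<close>, with \<open>\<alpha> - x\<close>, which
  decreases in the index, in place of \<open>\<alpha>\<close>.\<close>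

lemma bottom_node_J:
  assumes "I = {}"
  shows "1 \<in> J" "\<And>n. n \<in> N \<Longrightarrow> n \<noteq> 1 \<Longrightarrow> Y n - X n < Y 1 - X 1"
proof -
  obtain j where j: "j \<in> {1..s}" "x j < 1 / 2"
    using ex_lt by blast
  have s: "1 \<in> {1..s}" "x 1 < 1 / 2"
    using j x_less[of 1 j] by (cases "j = 1"; force)+
  then show 1: "1 \<in> J"
    using assms x_ne[of 1] by (auto simp: J I)
  then have Y1: "Y 1 = \<alpha> 1" "X 1 = x 1"
    by (rule JD)+
  fix n assume n: "n \<in> N" "n \<noteq> 1"
  from n(1) show "Y n - X n < Y 1 - X 1"
  proof (cases rule: N_cases)
    case 1
    then show ?thesis
      using \<alpha>_minus_x_less[of 1 n] n JD[of n] s Y1 by simp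
  next
    case 2
    then show ?thesis
      using assms by simp
  next
    case 3
    then have ij: "i1 \<in> {1..s}" "j1 \<in> {1..s}" "x i1 < 1 / 2" "1 / 2 < x j1"
      using max1 by (auto simp: maximal_chord_def)
    then have "i1 < j1"
      using x_less_iff[of i1 j1] by simp
    then have "\<alpha> j1 - x j1 < \<alpha> 1 - x 1" "\<alpha> i1 - x i1 \<le> \<alpha> 1 - x 1"
      using ij s \<alpha>_minus_x_less[of 1 j1] \<alpha>_minus_x_less[of 1 i1] by (cases "i1 = 1"; simp)+
    \<comment> \<open>The comparison line has slope 1 and passes through the first point.\<close>
    then have "chord x \<alpha> i1 j1 (1 / 2) < (\<alpha> 1 - x 1) + 1 * (1 / 2)"
      using ij by (intro chord_less_affine) auto
    then show ?thesis
      using 3 Y1 by (simp add: Y_def X_def)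
  qed
qed

text \<open>The chord from \<open>i1\<close> to \<open>j1\<close> then also straddles 1/q and
  competes there with the maximal one, so node \<open>0\<close> is not below its line;
  \<open>node_below\<close> leaves only the case of equal pairs.\<close>

lemma i1_in_I:
  assumes "K \<noteq> {}" "i1 \<in> I"
  shows "i0 = i1" "j0 = j1"
proof -
  have max: "maximal_chord (1 / q) i0 j0" "maximal_chord (1 / 2) i1 j1"
    using assms max0 max1 by auto
  have "1 / q < 1 / 2"
    using q by (simp add: field_simps)
  then have "chord x \<alpha> i1 j1 (1 / q) \<le> chord x \<alpha> i0 j0 (1 / q)"
    using max assms(2) by (auto simp: maximal_chord_def I)
  then have "chord x \<alpha> i1 j1 (X 0) \<le> Y 0"
    by (simp add: X_def Y_def)
  moreover have "0 \<in> N" "0 \<notin> J"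
    using assms ends_in_N ends_notin_J by blast+
  ultimately show "i0 = i1" "j0 = j1"
    using node_below[OF max(2) _ \<open>0 \<in> N\<close>] by auto
qed

text \<open>Symmetric to \<open>i1_in_I\<close>: the chord over 1/q also straddles 1/2.\<close>

lemma j0_in_K:
  assumes "I \<noteq> {}" "j0 \<in> K"
  shows "i1 = i0" "j1 = j0"
proof -
  have max: "maximal_chord (1 / q) i0 j0" "maximal_chord (1 / 2) i1 j1"
    using assms max0 max1 by auto
  have "1 / q < 1 / 2"
    using q by (simp add: field_simps)
  then have "chord x \<alpha> i0 j0 (1 / 2) \<le> chord x \<alpha> i1 j1 (1 / 2)"
    using max assms(2) by (auto simp: maximal_chord_def K)
  then have "chord x \<alpha> i0 j0 (X (Suc s)) \<le> Y (Suc s)"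
    by (simp add: X_def Y_def)
  moreover have "Suc s \<in> N" "Suc s \<notin> J"
    using assms ends_in_N ends_notin_J by blast+
  ultimately show "i1 = i0" "j1 = j0"
    using node_below[OF max(1) _ \<open>Suc s \<in> N\<close>] by auto
qed

end

section \<open>Which node carries which piece\<close>

locale envelope = chord_maximizers +
  fixes h :: "real \<Rightarrow> real" and L :: nat and t :: "nat \<Rightarrow> real" and g :: "nat \<Rightarrow> nat"
  assumes pieces: "pieces N intercept slope h 1 (q / 2) L t g"
begin

sublocale pieces N intercept slope h 1 "q / 2" L t g
  by (rule pieces)

lemma g_first_K:
  assumes "K \<noteq> {}"
  shows "g 1 = Suc s"
proof (rule first_piece)
  show "intercept n + slope n * 1 < intercept (Suc s) + slope (Suc s) * 1" if "n \<in> N - {Suc s}" for n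
    using top_node[OF assms, of n] that unfolding value_1 by blast
qed (rule ends_in_N(2)[OF assms])

lemma g_first_J:
  assumes "K = {}"
  shows "g 1 = s"
proof (rule first_piece)
  show "intercept n + slope n * 1 < intercept s + slope s * 1" if "n \<in> N - {s}" for n
    using top_node_J(2)[OF assms, of n] that unfolding value_1 by blast
qed (rule J_in_N[OF top_node_J(1)[OF assms]])

lemma g_last_I:
  assumes "I \<noteq> {}"
  shows "g L = 0"
proof (rule last_piece)
  show "intercept n + slope n * (q / 2) < intercept 0 + slope 0 * (q / 2)" if "n \<in> N - {0}" for n
    using bottom_node[OF assms, of n] that q unfolding value_half by simp
qed (rule ends_in_N(1)[OF assms])

lemma g_last_J:
  assumes "I = {}"
  shows "g L = 1"
proof (rule last_piece)
  show "intercept n + slope n * (q / 2) < intercept 1 + slope 1 * (q / 2)" if "n \<in> N - {1}" for n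
    using bottom_node_J(2)[OF assms, of n] that q unfolding value_half by simp
qed (rule J_in_N[OF bottom_node_J(1)[OF assms]])

text \<open>The nodes \<open>0\<close> and \<open>Suc s\<close>, when present, are taken by the last
  and the first piece, and no node occurs twice.\<close>

lemma g_inner:
  assumes "2 \<le> l" "l < L"
  shows "g l \<in> J"
proof -
  have "g l \<in> N"
    using assms by (intro g_node) auto
  then show ?thesis
    using g_first_K g_last_I g_inj[of l 1] g_inj[of l L] assms L
    by (cases rule: N_cases) fastforce+
qed

lemma g_antimono:
  assumes "1 \<le> k" "k < l" "l \<le> L" "g k \<in> J" "g l \<in> J"
  shows "g l < g k"
  using slope_less[OF assms(1-3)] slope_less_J[of "g k" "g l"] assms(4,5)
  by (cases "g k" "g l" rule: linorder_cases) auto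

lemma X_J_bounds: "n \<in> J \<Longrightarrow> 1 / q < X n" "n \<in> J \<Longrightarrow> X n < 1 / 2"
  using JD[of n] by (auto simp: J)

text \<open>The hull edge from \<open>i1\<close> to node \<open>Suc s\<close> lies on the maximal
  chord over 1/2, so these two nodes are adjacent in the sequence of pieces, and
  \<open>Suc s\<close> occurs only first.\<close>

lemma second_piece:
  assumes "K \<noteq> {}" "i1 \<in> J"
  shows "2 \<le> L" "g 2 = i1"
proof -
  have max: "maximal_chord (1 / 2) i1 j1"
    using max1 assms by blast
  have j1: "j1 \<notin> J" "i1 \<noteq> j1"
    using max assms(2) by (auto simp: maximal_chord_def J)
  have i0: "i0 \<noteq> i1" if "I \<noteq> {}"
    using max0[OF that] assms(2) by (auto simp: maximal_chord_def J)
  have nodes: "i1 \<in> N" "Suc s \<in> N"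
    using assms ends_in_N J_in_N by blast+
  \<comment> \<open>Equality would need \<open>n = j1\<close> in \<open>J\<close>, but
    \<open>j1\<close> lies right of 1/2, or node \<open>0\<close> with \<open>i0 = i1\<close>, but
    \<open>i0\<close> lies left of 1/q.\<close>
  have "Y n < chord x \<alpha> i1 j1 (X n)" if "n \<in> N" "n \<noteq> i1" "n \<noteq> Suc s" for n
    using node_below[OF max _ that(1)] that(2,3) j1 i0 ends_notin_J
    by (cases rule: N_cases[OF that(1)]) fastforce+
  then obtain \<tau> where "1 < \<tau>" "\<tau> < q / 2" "slope (Suc s) < slope i1"
    "intercept i1 + slope i1 * \<tau> = intercept (Suc s) + slope (Suc s) * \<tau>"
    "\<forall>n\<in>N - {i1, Suc s}. intercept n + slope n * \<tau> < intercept (Suc s) + slope (Suc s) * \<tau>"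
    using edge[OF max _ nodes] assms(2) JD[of i1] X_J_bounds[of i1]
    by (auto simp: X_def Y_def)
  then obtain l where "1 \<le> l" "l < L" "g l = Suc s" "g (Suc l) = i1"
    using crossing[OF nodes] by blast
  moreover have "l = 1"
    using g_inj[of l 1] g_first_K calculation assms by simp
  ultimately show "2 \<le> L" "g 2 = i1"
    by (simp_all add: numeral_2_eq_2)
qed

text \<open>Symmetric to \<open>second_piece\<close>, with the edge from node \<open>0\<close> to
  \<open>j0\<close> on the chord over 1/q.\<close>

lemma next_to_last_piece:
  assumes "I \<noteq> {}" "j0 \<in> J"
  shows "2 \<le> L" "g (L - 1) = j0"
proof -
  have max: "maximal_chord (1 / q) i0 j0"
    using max0 assms by blast
  have i0: "i0 \<notin> J" "i0 \<noteq> j0"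
    using max assms(2) by (auto simp: maximal_chord_def J)
  have j1: "j1 \<noteq> j0" if "K \<noteq> {}"
    using max1[OF that] assms(2) by (auto simp: maximal_chord_def J)
  have nodes: "0 \<in> N" "j0 \<in> N"
    using assms ends_in_N J_in_N by blast+
  have "Y n < chord x \<alpha> i0 j0 (X n)" if "n \<in> N" "n \<noteq> 0" "n \<noteq> j0" for n
    using node_below[OF max _ that(1)] that(2,3) i0 j1 ends_notin_J
    by (cases rule: N_cases[OF that(1)]) fastforce+
  then obtain \<tau> where "1 < \<tau>" "\<tau> < q / 2" "slope j0 < slope 0"
    "intercept 0 + slope 0 * \<tau> = intercept j0 + slope j0 * \<tau>"
    "\<forall>n\<in>N - {0, j0}. intercept n + slope n * \<tau> < intercept j0 + slope j0 * \<tau>"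
    using edge[OF max _ nodes] assms(2) JD[of j0] X_J_bounds[of j0] max
    by (auto simp: X_def Y_def maximal_chord_def)
  then obtain l where "1 \<le> l" "l < L" "g l = j0" "g (Suc l) = 0"
    using crossing[OF nodes] by blast
  moreover have "Suc l = L"
    using g_inj[of "Suc l" L] g_last_I calculation assms by simp
  ultimately show "2 \<le> L" "g (L - 1) = j0"
    by auto
qed

text \<open>A chord maximal over both 1/q and 1/2 makes the restricted hull a single edge joining
  \<open>0\<close> and \<open>Suc s\<close>, so these first and last nodes are adjacent.\<close>

lemma two_pieces:
  assumes ne: "I \<noteq> {}" "K \<noteq> {}" and same: "i0 = i1" "j0 = j1"
  shows "L = 2"
proof -
  have max: "maximal_chord (1 / q) i0 j0"
    using max0 ne by blast
  have "i0 \<notin> J" "j0 \<notin> J"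
    using max0 max1 ne same by (auto simp: maximal_chord_def J)
  then have "Y n < chord x \<alpha> i0 j0 (X n)" if "n \<in> N" "n \<noteq> 0" "n \<noteq> Suc s" for n
    using node_below[OF max _ that(1)] that by auto
  moreover have nodes: "0 \<in> N" "Suc s \<in> N"
    using ends_in_N ne by blast+
  moreover have "X 0 < X (Suc s)"
    using q by (simp add: ends_coordinates field_simps)
  moreover have "Y 0 = chord x \<alpha> i0 j0 (X 0)" "Y (Suc s) = chord x \<alpha> i0 j0 (X (Suc s))"
    unfolding ends_coordinates by (simp_all only: same)
  ultimately obtain \<tau> where "1 < \<tau>" "\<tau> < q / 2" "slope (Suc s) < slope 0"
    "intercept 0 + slope 0 * \<tau> = intercept (Suc s) + slope (Suc s) * \<tau>"
    "\<forall>n\<in>N - {0, Suc s}. intercept n + slope n * \<tau> < intercept (Suc s) + slope (Suc s) * \<tau>"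
    using edge[OF max, of 0 "Suc s"] by blast
  then obtain l where "1 \<le> l" "l < L" "g l = Suc s" "g (Suc l) = 0"
    using crossing[OF nodes] by blast
  then show "L = 2"
    using g_inj[of l 1] g_inj[of "Suc l" L] g_first_K g_last_I ne by simp
qed

end

subsection \<open>Exponents\<close>

text \<open>The value \<open>r = \<infinity>\<close> is included, where \<open>recip r\<close> is
  0.\<close>

lemma recip_less_iff:
  assumes "1 \<le> r" "0 < c"
  shows "recip r < 1 / c \<longleftrightarrow> ereal c < r"
  using assms by (cases r) (auto simp: recip_def field_simps one_ereal_def)

lemma recip_greater_iff:
  assumes "1 \<le> r" "0 < c"
  shows "1 / c < recip r \<longleftrightarrow> r < ereal c"
  using assms by (cases r) (auto simp: recip_def field_simps one_ereal_def)

text \<open>Solving the defining equation of the weight gives the relative position of 1/r between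
  the two reciprocals, so \<open>interp\<close> is linear interpolation at 1/r.\<close>

lemma interp_eq_chord:
  assumes "recip (p i) \<noteq> recip (p j)"
  shows "interp r \<alpha> p i j = chord (\<lambda>k. recip (p k)) \<alpha> i j (1 / r)"
proof -
  define w where "w = weight r p i j"
  have "1 / r = (1 - w) * recip (p i) + w * recip (p j)"
    using weight_unique[where p = p, OF assms] by (simp add: w_def)
  then have "w * (recip (p j) - recip (p i)) = 1 / r - recip (p i)"
    by (simp add: algebra_simps)
  then have w: "w = (1 / r - recip (p i)) / (recip (p j) - recip (p i))"
    using assms by (simp add: eq_divide_eq)
  have "chord (\<lambda>k. recip (p k)) \<alpha> i j (1 / r) = \<alpha> i + (\<alpha> j - \<alpha> i) * w"
    by (simp add: chord_def w)
  then show ?thesis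
    by (simp add: interp_def algebra_simps flip: w_def)
qed

theorem proposition1:
  fixes q :: real and s :: nat and \<alpha> :: "nat \<Rightarrow> real" and p :: "nat \<Rightarrow> ereal"
    and i0 j0 i1 j1 :: nat and L :: nat and t :: "nat \<Rightarrow> real"
    and I J K :: "nat set" and h :: "real \<Rightarrow> real"
  assumes q: "2 < q"
    and p: "\<And>j. j \<in> {1..s} \<Longrightarrow> 1 \<le> p j"
    and a1: "strict_mono_on {1..s} \<alpha>"
    and a2: "strict_antimono_on {1..s} (\<lambda>j. \<alpha> j - recip (p j))"
    and b1: "\<exists>j\<in>{1..s}. p j < ereal q"
    and b2: "\<exists>j\<in>{1..s}. p j > 2"
    and c: "\<And>j. j \<in> {1..s} \<Longrightarrow> p j \<notin> {2, ereal q}"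
    and d: "\<And>i j i' j'. \<lbrakk>i \<in> {1..s}; j \<in> {1..s}; i' \<in> {1..s}; j' \<in> {1..s};
          i > j; i' > j'; (i, j) \<noteq> (i', j')\<rbrakk> \<Longrightarrow>
          (\<alpha> i - \<alpha> j) / (recip (p i) - recip (p j)) \<noteq>
          (\<alpha> i' - \<alpha> j') / (recip (p i') - recip (p j'))"
    and I: "I = idxI q s p" and J: "J = idxJ q s p" and K: "K = idxK s p"
    and ij0: "I \<noteq> {} \<Longrightarrow>
          is_arg_max (\<lambda>(i, j). interp q \<alpha> p i j) (\<lambda>ij. ij \<in> I \<times> (J \<union> K)) (i0, j0)"
    and ij1: "K \<noteq> {} \<Longrightarrow>
          is_arg_max (\<lambda>(i, j). interp 2 \<alpha> p i j) (\<lambda>ij. ij \<in> (I \<union> J) \<times> K) (i1, j1)"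
    and h: "h = hmax q s \<alpha> p (i0, j0) (i1, j1)"
    and L: "1 \<le> L"
    and t_ends: "t 0 = 1" "t L = q/2"
    and t_mono: "strict_mono_on {0..L} t"
    and t_corners: "t ` {1..<L} = corner_points q h"
  shows "\<exists>jj :: nat \<Rightarrow> nat.
     (\<forall>l. 2 \<le> l \<and> l \<le> L - 1 \<longrightarrow>
        jj l \<in> J \<and> (\<forall>x\<in>{t (l - 1)..t l}. h x = phi q \<alpha> p (jj l) x)) \<and>
     (K = {} \<longrightarrow>
        jj 1 = s \<and> s \<in> J \<and> (\<forall>x\<in>{t 0..t 1}. h x = phi q \<alpha> p (jj 1) x)) \<and>
     (K \<noteq> {} \<longrightarrow>
        (\<forall>x\<in>{t 0..t 1}. ereal (h x) = h1 s \<alpha> p (i1, j1) x) \<and>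
        (i1 \<in> J \<longrightarrow>
          (\<exists>\<epsilon>>0. t 1 + \<epsilon> \<le> q/2 \<and> (\<forall>x\<in>{t 1..t 1 + \<epsilon>}. h x = phi q \<alpha> p i1 x))) \<and>
        (i1 \<in> I \<longrightarrow>
          L = 2 \<and> (i0, j0) = (i1, j1) \<and>
          (\<forall>x\<in>{t 1..t 2}. ereal (h x) = h0 q s \<alpha> p (i0, j0) x))) \<and>
     (I = {} \<longrightarrow>
        jj L = 1 \<and> 1 \<in> J \<and> (\<forall>x\<in>{t (L - 1)..t L}. h x = phi q \<alpha> p (jj L) x)) \<and>
     (I \<noteq> {} \<longrightarrow>
        (\<forall>x\<in>{t (L - 1)..t L}. ereal (h x) = h0 q s \<alpha> p (i0, j0) x) \<and>
        (j0 \<in> J \<longrightarrow>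
          (\<exists>\<epsilon>>0. 1 \<le> t (L - 1) - \<epsilon> \<and>
             (\<forall>x\<in>{t (L - 1) - \<epsilon>..t (L - 1)}. h x = phi q \<alpha> p j0 x))) \<and>
        (j0 \<in> K \<longrightarrow>
          L = 2 \<and> (i1, j1) = (i0, j0) \<and>
          (\<forall>x\<in>{t 0..t 1}. ereal (h x) = h1 s \<alpha> p (i1, j1) x))) \<and>
     strict_antimono_on (jdom q s p L) jj"
proof -
  note idx = I J K

  \<comment> \<open>Hypotheses in terms of the points \<open>(x j, \<alpha> j)\<close>\<close>
  define x where "x = (\<lambda>j. recip (p j))"
  have cmp_q: "x j < 1 / q \<longleftrightarrow> ereal q < p j" "1 / q < x j \<longleftrightarrow> p j < ereal q" if "j \<in> {1..s}" for j
    using p[OF that] q by (simp_all add: x_def recip_less_iff recip_greater_iff)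
  have cmp_2: "x j < 1 / 2 \<longleftrightarrow> 2 < p j" "1 / 2 < x j \<longleftrightarrow> p j < 2" if "j \<in> {1..s}" for j
    using recip_less_iff[OF p[OF that], of 2] recip_greater_iff[OF p[OF that], of 2]
    by (simp_all add: x_def)
  have \<alpha>_less: "\<alpha> i < \<alpha> j" and diff_less: "\<alpha> j - x j < \<alpha> i - x i"
    if "i \<in> {1..s}" "j \<in> {1..s}" "i < j" for i j
    using a1 a2 that by (auto simp: x_def monotone_on_def)
  have slope_ne: "(\<alpha> i - \<alpha> j) / (x i - x j) \<noteq> (\<alpha> i - \<alpha> k) / (x i - x k)"
    if ijk: "i \<in> {1..s}" "j \<in> {1..s}" "k \<in> {1..s}" and ne: "i \<noteq> j" "i \<noteq> k" "j \<noteq> k" for i j k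
  proof -
    \<comment> \<open>Condition (d) speaks of pairs with the larger index first; the quotient does
      not change when the two indices are swapped.\<close>
    have max_min: "(\<alpha> (max i j) - \<alpha> (min i j)) / (x (max i j) - x (min i j)) =
        (\<alpha> i - \<alpha> j) / (x i - x j)" for i j
      using minus_divide_divide[of "\<alpha> i - \<alpha> j" "x i - x j"] by (simp add: max_def min_def)
    have "(max i j, min i j) \<noteq> (max i k, min i k)"
      using ne by (auto simp: max_def min_def split: if_splits)
    moreover have "min i j < max i j" "min i k < max i k"
      using ne by auto
    moreover have "max i j \<in> {1..s}" "min i j \<in> {1..s}" "max i k \<in> {1..s}" "min i k \<in> {1..s}"
      using ijk by (auto simp: max_def min_def)
    ultimately have "(\<alpha> (max i j) - \<alpha> (min i j)) / (x (max i j) - x (min i j)) \<noteq>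
        (\<alpha> (max i k) - \<alpha> (min i k)) / (x (max i k) - x (min i k))"
      unfolding x_def by (intro d)
    then show ?thesis
      by (simp only: max_min not_False_eq_True)
  qed
  interpret exponents q s \<alpha> x
  proof
    show "2 < q"
      by (rule q)
    show "\<alpha> i < \<alpha> j" "\<alpha> j - x j < \<alpha> i - x i" if "i \<in> {1..s}" "j \<in> {1..s}" "i < j" for i j
      using \<alpha>_less[OF that] diff_less[OF that] by simp_all
    show "x j \<noteq> 1 / q \<and> x j \<noteq> 1 / 2" if "j \<in> {1..s}" for j
    proof -
      have "p j < 2 \<or> 2 < p j" "p j < ereal q \<or> ereal q < p j"
        using c[OF that] unfolding neq_iff[symmetric] by simp_all
      then show ?thesis
        unfolding cmp_q[OF that, symmetric] cmp_2[OF that, symmetric] by linarith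
    qed
    show "\<exists>j\<in>{1..s}. 1 / q < x j" "\<exists>j\<in>{1..s}. x j < 1 / 2"
      using b1 b2 cmp_q cmp_2 by blast+
    show "\<alpha> k \<noteq> chord x \<alpha> i j (x k)"
      if ijk: "i \<in> {1..s}" "j \<in> {1..s}" "k \<in> {1..s}" and less: "x i < x j" and ne: "k \<noteq> i" "k \<noteq> j"
      for i j k
    proof
      assume eq: "\<alpha> k = chord x \<alpha> i j (x k)"
      have "x k \<noteq> x i"
        using \<alpha>_less[of i k] \<alpha>_less[of k i] diff_less[of i k] diff_less[of k i] ijk ne
        by (cases i k rule: linorder_cases) auto
      moreover have "\<alpha> k - \<alpha> i = (\<alpha> j - \<alpha> i) / (x j - x i) * (x k - x i)"
        using eq by (simp add: chord_def)
      ultimately have "(\<alpha> k - \<alpha> i) / (x k - x i) = (\<alpha> j - \<alpha> i) / (x j - x i)"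
        by simp
      then have "(\<alpha> i - \<alpha> k) / (x i - x k) = (\<alpha> i - \<alpha> j) / (x i - x j)"
        using minus_divide_divide[of "\<alpha> k - \<alpha> i" "x k - x i"]
          minus_divide_divide[of "\<alpha> j - \<alpha> i" "x j - x i"] by simp
      then show False
        using slope_ne[of i k j] ijk ne less by auto
    qed
  qed
  have I_x: "I = {j \<in> {1..s}. x j < 1 / q}"
    using cmp_q by (auto simp: I idxI_def)
  have J_x: "J = {j \<in> {1..s}. 1 / q < x j \<and> x j < 1 / 2}"
    using cmp_q cmp_2 by (auto simp: J idxJ_def)
  have K_x: "K = {j \<in> {1..s}. 1 / 2 < x j}"
    using cmp_2 by (auto simp: K idxK_def)
  have q2: "1 / q < 1 / 2"
    using q by (simp add: field_simps)
  have interp: "interp r \<alpha> p i j = chord x \<alpha> i j (1 / r)" if "x i < x j" for r i j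
    using interp_eq_chord[of p i j r \<alpha>] that by (simp add: x_def)
  have max0: "maximal_chord (1 / q) i0 j0" if "I \<noteq> {}"
  proof -
    \<comment> \<open>As no \<open>x j\<close> equals 1/2, these are all indices right of 1/q, so
      the maximizer competes with every chord that straddles 1/q.\<close>
    have JK: "J \<union> K = {j \<in> {1..s}. 1 / q < x j}"
      using q2 x_ne unfolding J_x K_x by (force simp: neq_iff)
    have "i0 \<in> I" "j0 \<in> J \<union> K"
      and "\<And>k l. k \<in> I \<Longrightarrow> l \<in> J \<union> K \<Longrightarrow> interp q \<alpha> p k l \<le> interp q \<alpha> p i0 j0"
      using ij0[OF that] by (auto simp: is_arg_max_linorder)
    then show ?thesis
      using interp unfolding maximal_chord_def JK I_x by fastforce
  qed
  have max1: "maximal_chord (1 / 2) i1 j1" if "K \<noteq> {}"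
  proof -
    have IJ: "I \<union> J = {j \<in> {1..s}. x j < 1 / 2}"
      using q2 x_ne unfolding I_x J_x by (force simp: neq_iff)
    have "i1 \<in> I \<union> J" "j1 \<in> K"
      and "\<And>k l. k \<in> I \<union> J \<Longrightarrow> l \<in> K \<Longrightarrow> interp 2 \<alpha> p k l \<le> interp 2 \<alpha> p i1 j1"
      using ij1[OF that] by (auto simp: is_arg_max_linorder)
    then show ?thesis
      using interp unfolding maximal_chord_def IJ K_x by fastforce
  qed
  interpret chord_maximizers q s \<alpha> x i0 j0 i1 j1 I J K
    by unfold_locales (fact I_x J_x K_x max0 max1)+

  \<comment> \<open>The function \<open>h\<close> as the maximum over the nodes\<close>
  have phi: "phi q \<alpha> p n y = intercept n + slope n * y" if "n \<in> J" for n y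
  proof -
    have recip: "recip (p n) = x n"
      by (simp add: x_def)
    have "phi q \<alpha> p n y = y * (Y n - intercept n) + intercept n"
      unfolding phi_def intercept_def recip JD(2,3)[OF that] by (rule refl)
    then show ?thesis
      by (simp add: slope_def mult.commute)
  qed
  have h0: "h0 q s \<alpha> p (i0, j0) y = (if I = {} then -\<infinity> else ereal (intercept 0 + slope 0 * y))" for y
  proof (cases "I = {}")
    case False
    then have "interp q \<alpha> p i0 j0 = Y 0"
      unfolding ends_coordinates using max0 by (intro interp) (auto simp: maximal_chord_def)
    then show ?thesis
      using False unfolding h0_def idx[symmetric] by (simp add: slope_def mult.commute)
  qed (simp add: h0_def flip: idx)
  have h1: "h1 s \<alpha> p (i1, j1) y = (if K = {} then -\<infinity> else ereal (intercept (Suc s) + slope (Suc s) * y))" for y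
  proof (cases "K = {}")
    case False
    then have "interp 2 \<alpha> p i1 j1 = Y (Suc s)"
      unfolding ends_coordinates using max1 by (intro interp) (auto simp: maximal_chord_def)
    then show ?thesis
      using False unfolding h1_def idx[symmetric] by (simp add: slope_def algebra_simps)
  qed (simp add: h1_def flip: idx)
  have h2: "h2 q s \<alpha> p y = (if J = {} then -\<infinity> else ereal (MAX n\<in>J. intercept n + slope n * y))" for y
    using phi unfolding h2_def idx[symmetric] by simp
  have fin_J: "finite J"
    using finite_N by (simp add: N_def)
  \<comment> \<open>Either \<open>Suc s\<close> is a node or \<open>K\<close> is empty and
    \<open>s\<close> is in \<open>J\<close>; hence the maximum below is not
    \<open>-\<infinity>\<close>.\<close>
  have N_ne: "N \<noteq> {}"
    using top_node_J(1) J_in_N ends_in_N by blast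
  have "max_affine N intercept slope h"
  proof
    show "finite N"
      by (rule finite_N)
    fix y
    \<comment> \<open>The extended-real maximum inside \<open>hmax\<close>: it is attained by a
      node, hence finite, and \<open>real_of_ereal\<close> keeps its value.\<close>
    let ?E = "max (h0 q s \<alpha> p (i0, j0) y) (max (h1 s \<alpha> p (i1, j1) y) (h2 q s \<alpha> p y))"
    have le: "ereal (intercept n + slope n * y) \<le> ?E" if "n \<in> N" for n
      using that
    proof (cases rule: N_cases)
      case 1
      then have "ereal (intercept n + slope n * y) \<le> h2 q s \<alpha> p y"
        using fin_J by (auto simp: h2)
      then show ?thesis
        by (simp add: le_max_iff_disj)
    qed (simp_all add: h0 h1 le_max_iff_disj)
    then have "?E \<noteq> -\<infinity>"
      using N_ne by force
    moreover have "?E = h0 q s \<alpha> p (i0, j0) y \<or> ?E = h1 s \<alpha> p (i1, j1) y \<or> ?E = h2 q s \<alpha> p y"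
      by (simp add: max_def)
    moreover have "(MAX n\<in>J. intercept n + slope n * y) \<in> (\<lambda>n. intercept n + slope n * y) ` J" if "J \<noteq> {}"
      using fin_J that by (intro Max_in) auto
    ultimately have "\<exists>n\<in>N. ?E = ereal (intercept n + slope n * y)"
      using ends_in_N J_in_N unfolding h0 h1 h2 by (fastforce split: if_splits)
    then obtain n where n: "n \<in> N" "?E = ereal (intercept n + slope n * y)"
      by blast
    then have hy: "h y = intercept n + slope n * y"
      by (simp add: h hmax_def)
    then show "\<exists>n\<in>N. h y = intercept n + slope n * y"
      using n by blast
    show "intercept m + slope m * y \<le> h y" if "m \<in> N" for m
      using le[OF that] n hy by simp
  qed
  then interpret max_affine_corners N intercept slope h 1 "q / 2" L t
    using L t_ends t_mono t_corners
    by (intro max_affine_corners.intro max_affine_corners_axioms.intro)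
      (simp_all add: corner_points_def)
  obtain g where g: "\<forall>l\<in>{1..L}. g l \<in> N \<and> (\<forall>y\<in>{t (l - 1)..t l}. h y = intercept (g l) + slope (g l) * y)"
    using bchoice[of "{1..L}" "\<lambda>l n. n \<in> N \<and> (\<forall>y\<in>{t (l - 1)..t l}. h y = intercept n + slope n * y)"]
      piece_exists by blast
  have "pieces N intercept slope h 1 (q / 2) L t g"
    using g by unfold_locales blast+
  then interpret envelope q s \<alpha> x i0 j0 i1 j1 I J K h L t g
    by (intro envelope.intro envelope_axioms.intro chord_maximizers_axioms)

  \<comment> \<open>Reading off the six claims\<close>
  have eq_phi: "h y = phi q \<alpha> p (g l) y" if "l \<in> {1..L}" "g l \<in> J" "y \<in> {t (l - 1)..t l}" for l y
    using g_eq[of l y] phi that by simp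
  have first_K: "\<forall>y\<in>{t 0..t 1}. ereal (h y) = h1 s \<alpha> p (i1, j1) y" if "K \<noteq> {}"
    using g_eq[of 1] g_first_K[OF that] L that by (simp add: h1)
  have last_I: "\<forall>y\<in>{t (L - 1)..t L}. ereal (h y) = h0 q s \<alpha> p (i0, j0) y" if "I \<noteq> {}"
    using g_eq[of L] g_last_I[OF that] L that by (simp add: h0)
  have i1_I: "L = 2 \<and> i0 = i1 \<and> j0 = j1" if "K \<noteq> {}" "i1 \<in> I"
    using i1_in_I[OF that] two_pieces[OF _ that(1)] that(2) by auto
  have j0_K: "L = 2 \<and> i1 = i0 \<and> j1 = j0" if "I \<noteq> {}" "j0 \<in> K"
    using j0_in_K[OF that] two_pieces[OF that(1)] that(2) by auto
  have jdom: "1 \<le> l \<and> l \<le> L \<and> g l \<in> J" if "l \<in> jdom q s p L" for l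
    using that g_inner[of l] g_first_J top_node_J(1) g_last_J bottom_node_J(1) L
    by (auto simp: jdom_def simp flip: idx split: if_splits)
  \<comment> \<open>The map \<open>g\<close> itself is the witness: on \<open>jdom\<close> its
    values lie in \<open>J\<close>, while the nodes \<open>0\<close> and \<open>Suc s\<close> occur
    only outside it.\<close>
  show ?thesis
  proof (intro exI[of _ g] conjI allI impI)
    fix l assume l: "2 \<le> l \<and> l \<le> L - 1"
    then show "g l \<in> J"
      by (intro g_inner) auto
    then show "\<forall>y\<in>{t (l - 1)..t l}. h y = phi q \<alpha> p (g l) y"
      using eq_phi l by auto
  next
    assume "K = {}"
    then show "g 1 = s" "s \<in> J"
      using g_first_J top_node_J(1) by blast+
    then show "\<forall>y\<in>{t 0..t 1}. h y = phi q \<alpha> p (g 1) y"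
      using eq_phi[of 1] L by auto
  next
    assume "K \<noteq> {}" "i1 \<in> J"
    note second = second_piece[OF this]
    \<comment> \<open>The whole second piece serves as the right semi-neighbourhood.\<close>
    have "t 1 < t 2" "t 2 \<le> q / 2"
      using second t_less[of 1 2] t_less[of 2 L] ends by (cases "L = 2"; simp)+
    moreover have "h y = phi q \<alpha> p i1 y" if "y \<in> {t 1..t 2}" for y
      using eq_phi[of 2 y] second \<open>i1 \<in> J\<close> that by simp
    ultimately show "\<exists>\<epsilon>>0. t 1 + \<epsilon> \<le> q / 2 \<and> (\<forall>y\<in>{t 1..t 1 + \<epsilon>}. h y = phi q \<alpha> p i1 y)"
      by (intro exI[of _ "t 2 - t 1"]) simp
  next
    assume K: "K \<noteq> {}"
    show "\<forall>y\<in>{t 0..t 1}. ereal (h y) = h1 s \<alpha> p (i1, j1) y"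
      by (rule first_K[OF K])
    assume i1: "i1 \<in> I"
    show L2: "L = 2" and "(i0, j0) = (i1, j1)"
      using i1_I[OF K i1] by simp_all
    show "\<forall>y\<in>{t 1..t 2}. ereal (h y) = h0 q s \<alpha> p (i0, j0) y"
      using last_I i1 L2 by force
  next
    assume "I = {}"
    then show "g L = 1" "1 \<in> J"
      using g_last_J bottom_node_J(1) by blast+
    then show "\<forall>y\<in>{t (L - 1)..t L}. h y = phi q \<alpha> p (g L) y"
      using eq_phi[of L] L by auto
  next
    assume "I \<noteq> {}" "j0 \<in> J"
    note last_but_one = next_to_last_piece[OF this]
    \<comment> \<open>The whole piece \<open>L - 1\<close> serves as the left semi-neighbourhood.
      Since \<open>2 \<le> L\<close>, the subtraction is exact; for \<open>L = 2\<close> the piece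
      starts at \<open>t 0 = 1\<close>.\<close>
    have "t (L - 2) < t (L - 1)" "1 \<le> t (L - 2)"
      using last_but_one t_less[of "L - 2" "L - 1"] t_less[of 0 "L - 2"] ends
      by (cases "L = 2"; simp)+
    moreover have "h y = phi q \<alpha> p j0 y" if "y \<in> {t (L - 2)..t (L - 1)}" for y
      using eq_phi[of "L - 1" y] last_but_one \<open>j0 \<in> J\<close> that by (simp add: numeral_2_eq_2)
    ultimately show "\<exists>\<epsilon>>0. 1 \<le> t (L - 1) - \<epsilon> \<and>
        (\<forall>y\<in>{t (L - 1) - \<epsilon>..t (L - 1)}. h y = phi q \<alpha> p j0 y)"
      by (intro exI[of _ "t (L - 1) - t (L - 2)"]) simp
  next
    assume I: "I \<noteq> {}"
    show "\<forall>y\<in>{t (L - 1)..t L}. ereal (h y) = h0 q s \<alpha> p (i0, j0) y"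
      by (rule last_I[OF I])
    assume j0: "j0 \<in> K"
    show L2: "L = 2" and "(i1, j1) = (i0, j0)"
      using j0_K[OF I j0] by simp_all
    show "\<forall>y\<in>{t 0..t 1}. ereal (h y) = h1 s \<alpha> p (i1, j1) y"
      using first_K j0 by blast
  next
    show "strict_antimono_on (jdom q s p L) g"
      using g_antimono jdom by (auto intro!: monotone_onI)
  qed
qed

end
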